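(* Let $G=(V,E)$ be a finite, connected, simple graph and let $\lambda_1$ be the first (smallest) nonzero eigenvalue of the graph Laplacian $\Delta=I-D^{-1}A$, where $A$ is the adjacency matrix and $D$ the diagonal matrix of vertex degrees. For any $\kappa_0>0$ and any $\alpha\in[0,1)$, \[ \lambda_1\ge \kappa_0-\frac{I^\alpha_{\kappa_0}}{1-\alpha} \qquad\text{and}\qquad \lambda_1\ge \kappa_0-I_{\kappa_0}. \]
   Context: $G=(V,E)$ is a finite, connected, simple graph; $d(x,y)$ is the graph distance. For $x\in V$, $\Gamma(x)=\{v: vx\in E\}$, $d_x=|\Gamma(x)|$. For probability measures $m_1,m_2$ on $V$, $W(m_1,m_2)=\inf_A\sum_{x,y\in V}A(x,y)d(x,y)$ over couplings $A:V\times V\to[0,1]$ with $\sum_y A(x,y)=m_1(x)$, $\sum_x A(x,y)=m_2(y)$. For $\alpha\in[0,1)$ let $m^\alpha_x(v)=\alpha$ if $v=x$, $(1-\alpha)/d_x$ if $v\in\Gamma(x)$, $0$ otherwise; $\kappa_\alpha(x,y)=1-W(m^\alpha_x,m^\alpha_y)/d(x,y)$ for $x\neq y$; $\kappa_{LLY}(x,y)=\lim_{\alpha\to1^-}\kappa_\alpha(x,y)/(1-\alpha)$ (this limit exists). For $\kappa_0\in\mathbb{R}$, $\rho^\alpha_{\kappa_0}(x,y)=\max\{0,(1-\alpha)\kappa_0-\kappa_\alpha(x,y)\}$, $\rho_{\kappa_0}(x,y)=\max\{0,\kappa_0-\kappa_{LLY}(x,y)\}$, $I^\alpha_{\kappa_0}=\sum_{xy\in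 E}\rho^\alpha_{\kappa_0}(x,y)$, $I_{\kappa_0}=\sum_{xy\in E}\rho_{\kappa_0}(x,y)$ (sums over edges, each counted once). *)

theory Defs
  imports "HOL-Analysis.Analysis"
begin

text \<open>The vertex set is the finite type \<^typ>\<open>'a\<close>; a graph is given by its set of (undirected) edges,
  which are two-element sets of vertices.\<close>

definition simple_graph :: "'a set set \<Rightarrow> bool" where
  "simple_graph E \<longleftrightarrow> (\<forall>e\<in>E. card e = 2)"

definition adj :: "'a set set \<Rightarrow> ('a \<times> 'a) set" where
  "adj E = {(x, y). {x, y} \<in> E}"

definition connected_graph :: "'a set set \<Rightarrow> bool" where
  "connected_graph E \<longleftrightarrow> (\<forall>x y. (x, y) \<in> (adj E)\<^sup>*)"

definition graph_dist :: "'a set set \<Rightarrow> 'a \<Rightarrow> 'a \<Rightarrow> nat" where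
  "graph_dist E x y = (LEAST n. (x, y) \<in> adj E ^^ n)"

definition nbrs :: "'a set set \<Rightarrow> 'a \<Rightarrow> 'a set" where
  "nbrs E x = {v. {v, x} \<in> E}"

definition deg :: "'a set set \<Rightarrow> 'a \<Rightarrow> nat" where
  "deg E x = card (nbrs E x)"

definition coupling :: "('a::finite \<Rightarrow> real) \<Rightarrow> ('a \<Rightarrow> real) \<Rightarrow> ('a \<Rightarrow> 'a \<Rightarrow> real) \<Rightarrow> bool" where
  "coupling m1 m2 A \<longleftrightarrow>
     (\<forall>x y. A x y \<in> {0..1}) \<and>
     (\<forall>x. (\<Sum>y\<in>UNIV. A x y) = m1 x) \<and>
     (\<forall>y. (\<Sum>x\<in>UNIV. A x y) = m2 y)"

definition wasserstein ::
    "'a::finite set set \<Rightarrow> ('a \<Rightarrow> real) \<Rightarrow> ('a \<Rightarrow> real) \<Rightarrow> real" where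
  "wasserstein E m1 m2 =
     (INF A\<in>{A. coupling m1 m2 A}. \<Sum>x\<in>UNIV. \<Sum>y\<in>UNIV. A x y * real (graph_dist E x y))"

definition walk_measure :: "'a set set \<Rightarrow> real \<Rightarrow> 'a \<Rightarrow> 'a \<Rightarrow> real" where
  "walk_measure E \<alpha> x v =
     (if v = x then \<alpha> else if v \<in> nbrs E x then (1 - \<alpha>) / real (deg E x) else 0)"

definition curv :: "'a::finite set set \<Rightarrow> real \<Rightarrow> 'a \<Rightarrow> 'a \<Rightarrow> real" where
  "curv E \<alpha> x y =
     1 - wasserstein E (walk_measure E \<alpha> x) (walk_measure E \<alpha> y) / real (graph_dist E x y)"

definition curv_LLY :: "'a::finite set set \<Rightarrow> 'a \<Rightarrow> 'a \<Rightarrow> real" where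
  "curv_LLY E x y = Lim (at_left 1) (\<lambda>\<alpha>. curv E \<alpha> x y / (1 - \<alpha>))"

definition deficit :: "'a::finite set set \<Rightarrow> real \<Rightarrow> real \<Rightarrow> 'a \<Rightarrow> 'a \<Rightarrow> real" where
  "deficit E \<alpha> \<kappa>0 x y = max 0 ((1 - \<alpha>) * \<kappa>0 - curv E \<alpha> x y)"

definition deficit_LLY :: "'a::finite set set \<Rightarrow> real \<Rightarrow> 'a \<Rightarrow> 'a \<Rightarrow> real" where
  "deficit_LLY E \<kappa>0 x y = max 0 (\<kappa>0 - curv_LLY E x y)"

text \<open>Each edge contributes once.  The choice only fixes an orientation \<open>(x, y)\<close> of the edge
  \<open>{x, y}\<close>; it is immaterial for symmetric \<open>f\<close>, such as the two functions above.\<close>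

definition edge_sum :: "'a set set \<Rightarrow> ('a \<Rightarrow> 'a \<Rightarrow> real) \<Rightarrow> real" where
  "edge_sum E f = (\<Sum>e\<in>E. SOME r. \<exists>x y. e = {x, y} \<and> r = f x y)"

definition total_deficit :: "'a::finite set set \<Rightarrow> real \<Rightarrow> real \<Rightarrow> real" where
  "total_deficit E \<alpha> \<kappa>0 = edge_sum E (deficit E \<alpha> \<kappa>0)"

definition total_deficit_LLY :: "'a::finite set set \<Rightarrow> real \<Rightarrow> real" where
  "total_deficit_LLY E \<kappa>0 = edge_sum E (deficit_LLY E \<kappa>0)"

definition adj_matrix :: "'a::finite set set \<Rightarrow> real^'a^'a" where
  "adj_matrix E = (\<chi> x y. if {x, y} \<in> E then 1 else 0)"

definition deg_matrix :: "'a::finite set set \<Rightarrow> real^'a^'a" where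
  "deg_matrix E = (\<chi> x y. if x = y then real (deg E x) else 0)"

definition laplacian :: "'a::finite set set \<Rightarrow> real^'a^'a" where
  "laplacian E = mat 1 - matrix_inv (deg_matrix E) ** adj_matrix E"

definition eigenvalue :: "real^'n^'n \<Rightarrow> real \<Rightarrow> bool" where
  "eigenvalue M c \<longleftrightarrow> (\<exists>v. v \<noteq> 0 \<and> M *v v = c *\<^sub>R v)"

text \<open>The Laplacian is similar to a real symmetric matrix, so restricting to real eigenvalues loses
  nothing.  For a connected graph with at least two vertices the set below is finite and
  nonempty.\<close>

definition lambda1 :: "'a::finite set set \<Rightarrow> real" where
  "lambda1 E = Min {c. eigenvalue (laplacian E) c \<and> c \<noteq> 0}"

end

theory Submission
  imports Defs
begin

text \<open>Let \<open>f\<close> be an eigenvector for a nonzero eigenvalue \<open>c\<close>, and let \<open>{x, y}\<close> be an edge on which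
  the increment of \<open>f\<close> is maximal in absolute value, so that \<open>f\<close> is Lipschitz with constant
  \<open>K = \<bar>f x - f y\<bar>\<close>.  Integrating \<open>f\<close> against the walk measure at \<open>v\<close> gives \<open>(1 - (1 - \<alpha>) * c) * f v\<close>,
  so the easy half of Kantorovich duality yields \<open>1 - (1 - \<alpha>) * c \<le> W\<close>, that is,
  \<open>curv E \<alpha> x y \<le> (1 - \<alpha>) * c\<close>.  The deficit of this single edge is bounded by the total deficit.
  For the limit version, convexity of the Wasserstein distance makes \<open>curv E \<alpha> x y / (1 - \<alpha>)\<close>
  nondecreasing in \<open>\<alpha>\<close>; being bounded by \<open>c\<close> on this edge, it converges there, to a value at
  most \<open>c\<close>.\<close>

section \<open>Eigenvalues of self-adjoint operators\<close>

text \<open>Eigenvectors for distinct eigenvalues are orthogonal, so choosing one for each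
  eigenvalue yields an independent set, which is finite in a Euclidean space.\<close>

lemma finite_eigenvalues_self_adjoint:
  fixes T :: "'v::euclidean_space \<Rightarrow> 'v"
  assumes "\<And>u v. u \<bullet> T v = T u \<bullet> v"
  shows "finite {c. \<exists>v. v \<noteq> 0 \<and> T v = c *\<^sub>R v}" (is "finite ?C")
proof -
  define g where "g c = (SOME v. v \<noteq> 0 \<and> T v = c *\<^sub>R v)" for c
  have "g c \<noteq> 0 \<and> T (g c) = c *\<^sub>R g c" if "c \<in> ?C" for c
    unfolding g_def by (rule someI_ex) (use that in simp)
  then have nz: "g c \<noteq> 0" and eig: "T (g c) = c *\<^sub>R g c" if "c \<in> ?C" for c
    using that by blast+
  have orth: "g c \<bullet> g d = 0" if cd: "c \<in> ?C" "d \<in> ?C" "c \<noteq> d" for c d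
  proof -
    have "c * (g c \<bullet> g d) = d * (g c \<bullet> g d)"
      using assms[of "g c" "g d"] by (simp only: eig[OF cd(1)] eig[OF cd(2)]
        inner_scaleR_left inner_scaleR_right)
    with cd(3) show ?thesis
      by (metis mult_cancel_right)
  qed
  have inj: "inj_on g ?C"
  proof (rule inj_onI, rule ccontr)
    fix c d
    assume cd: "c \<in> ?C" "d \<in> ?C" and "g c = g d" "c \<noteq> d"
    then show False
      using orth[OF cd] nz[OF cd(2)] by (metis inner_eq_zero_iff)
  qed
  have "independent (g ` ?C)"
  proof (rule pairwise_orthogonal_independent)
    show "pairwise orthogonal (g ` ?C)"
      unfolding pairwise_image
      by (rule pairwiseI) (use orth in \<open>simp only: orthogonal_def simp_thms\<close>)
    show "0 \<notin> g ` ?C"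
      by (rule notI, erule imageE) (metis nz)
  qed
  then have "finite (g ` ?C)"
    by (rule independent_imp_finite)
  then show ?thesis
    using inj by (rule finite_imageD)
qed

text \<open>Otherwise a short step from \<open>g\<close> against \<open>U g\<close> would make the
  quadratic form negative: its first-order term is strictly negative.\<close>

lemma positive_semidefinite_kernel:
  fixes U :: "'v::real_inner \<Rightarrow> 'v"
  assumes lin: "linear U" and adj: "\<And>u v. u \<bullet> U v = U u \<bullet> v"
    and pos: "\<And>v. v \<bullet> U v \<ge> 0" and "g \<bullet> U g = 0"
  shows "U g = 0"
proof (rule ccontr)
  assume "U g \<noteq> 0"
  define w where "w = U g"
  define n c where "n = w \<bullet> w" and "c = w \<bullet> U w"
  have "n > 0"
    using \<open>U g \<noteq> 0\<close> by (simp add: n_def w_def)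
  have "c \<ge> 0"
    by (simp add: c_def pos)
  \<comment> \<open>The form at \<open>g - s *\<^sub>R w\<close> is
    \<open>s * (s * c - 2 * n)\<close>, and this \<open>s\<close> keeps \<open>s * c\<close> at most
    \<open>n\<close>. Adding 1 keeps the denominator positive when \<open>c = 0\<close>.\<close>
  define s where "s = n / (c + 1)"
  have "s > 0"
    using \<open>n > 0\<close> \<open>c \<ge> 0\<close> by (simp add: s_def)
  have "U (g - s *\<^sub>R w) = w - s *\<^sub>R U w"
    by (simp add: lin linear_diff linear_scale w_def)
  moreover have "g \<bullet> U w = w \<bullet> w" "g \<bullet> w = 0"
    using adj[of g w] assms(4) by (simp_all add: w_def)
  ultimately have "(g - s *\<^sub>R w) \<bullet> U (g - s *\<^sub>R w) = s * (s * c - 2 * n)"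
    by (simp add: inner_diff_left inner_diff_right n_def c_def right_diff_distrib)
  then have "s * c \<ge> 2 * n"
    using pos[of "g - s *\<^sub>R w"] \<open>s > 0\<close> by (simp add: zero_le_mult_iff)
  moreover have "s * c \<le> n"
    using \<open>n > 0\<close> \<open>c \<ge> 0\<close> by (simp add: s_def field_simps)
  ultimately show False
    using \<open>n > 0\<close> by simp
qed

text \<open>The Rayleigh quotient attains its maximum on the compact unit sphere; the maximum is an
  eigenvalue, and the vector \<open>a\<close> makes it positive.\<close>

lemma positive_eigenvalue_exists:
  fixes T :: "'v::euclidean_space \<Rightarrow> 'v"
  assumes lin: "linear T" and adj: "\<And>u v. u \<bullet> T v = T u \<bullet> v" and "a \<bullet> T a > 0"
  shows "\<exists>c>0. \<exists>v. v \<noteq> 0 \<and> T v = c *\<^sub>R v"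
proof -
  have "a \<noteq> 0"
    using assms(3) by auto
  then have ne: "sphere (0::'v) 1 \<noteq> {}"
    by (metis norm_sgn mem_sphere_0 empty_iff)
  have "continuous_on (sphere 0 1) (\<lambda>v. v \<bullet> T v)"
    using linear_continuous_on[OF lin[unfolded linear_conv_bounded_linear]]
    by (intro continuous_intros)
  then obtain g where g: "norm g = 1" and max: "\<And>v. norm v = 1 \<Longrightarrow> v \<bullet> T v \<le> g \<bullet> T g"
    using continuous_attains_sup[OF compact_sphere ne] by (metis mem_sphere_0)
  define c where "c = g \<bullet> T g"
  have rayleigh: "v \<bullet> T v \<le> c * (v \<bullet> v)" for v
  proof (cases "v = 0")
    case False
    have "sgn v \<bullet> T (sgn v) = v \<bullet> T v / (v \<bullet> v)"
      by (simp add: sgn_div_norm linear_scale[OF lin] dot_square_norm power2_eq_square field_simps)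
    then show ?thesis
      using mult_right_mono[OF max[of "sgn v"], of "v \<bullet> v"] False by (simp add: c_def norm_sgn)
  qed (simp add: linear_0[OF lin])
  have "c * (a \<bullet> a) > 0"
    using rayleigh[of a] assms(3) by simp
  then have "c > 0"
    by (metis inner_ge_zero zero_less_mult_pos2 \<open>a \<noteq> 0\<close> inner_gt_zero_iff)
  \<comment> \<open>By the Rayleigh bound \<open>U\<close> is positive semidefinite, and its form
    vanishes at the maximizer \<open>g\<close>; the kernel lemma then replaces a Lagrange multiplier
    argument.\<close>
  define U where "U v = c *\<^sub>R v - T v" for v
  have "U g = 0"
  proof (rule positive_semidefinite_kernel[where U = U and g = g])
    show "linear U"
      unfolding U_def by (intro linear_compose_sub linear_scale_self lin)
    show "u \<bullet> U v = U u \<bullet> v" for u v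
      by (simp add: U_def inner_diff_left inner_diff_right adj)
    show "v \<bullet> U v \<ge> 0" for v
      using rayleigh by (simp add: U_def inner_diff_right)
    show "g \<bullet> U g = 0"
      using g by (simp add: U_def inner_diff_right c_def dot_square_norm)
  qed
  then show ?thesis
    using \<open>c > 0\<close> g by (metis U_def eq_iff_diff_eq_0 norm_zero zero_neq_one)
qed

section \<open>Graphs and their Laplacian\<close>

lemma mem_nbrs_commute: "y \<in> nbrs E x \<longleftrightarrow> x \<in> nbrs E y"
  by (simp add: nbrs_def insert_commute)

lemma not_self_nbr: "simple_graph E \<Longrightarrow> x \<notin> nbrs E x"
  by (auto simp: simple_graph_def nbrs_def)

text \<open>A walk from \<open>x\<close> to some other vertex has a first edge, and this edge leads
  to a neighbour of \<open>x\<close>.\<close>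

lemma deg_pos:
  fixes E :: "'a::finite set set"
  assumes "connected_graph E" and "CARD('a) \<ge> 2"
  shows "deg E x > 0"
proof -
  have "UNIV \<noteq> {x}"
    using assms(2) by (metis One_nat_def card.empty card.insert empty_iff finite.emptyI
      not_less_eq_eq numeral_2_eq_2 order_refl)
  then obtain y where "y \<noteq> x"
    by auto
  moreover have "(x, y) \<in> (adj E)\<^sup>*"
    using assms(1) by (simp add: connected_graph_def)
  ultimately obtain z where "(x, z) \<in> adj E"
    by (metis converse_rtranclE)
  then have "z \<in> nbrs E x"
    by (simp add: adj_def nbrs_def insert_commute)
  then show ?thesis
    by (auto simp: deg_def card_gt_0_iff)
qed

lemma graph_dist_relpow:
  assumes "connected_graph E"
  shows "(x, y) \<in> adj E ^^ graph_dist E x y"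
proof -
  have "\<exists>n. (x, y) \<in> adj E ^^ n"
    using assms by (simp add: connected_graph_def rtrancl_imp_relpow)
  then show ?thesis
    unfolding graph_dist_def by (rule LeastI_ex)
qed

lemma graph_dist_adjacent:
  assumes "simple_graph E" and "{x, y} \<in> E"
  shows "graph_dist E x y = 1"
  unfolding graph_dist_def
proof (rule Least_equality)
  show "(x, y) \<in> adj E ^^ 1"
    using assms(2) by (simp add: adj_def)
  show "1 \<le> n" if "(x, y) \<in> adj E ^^ n" for n
    using that assms by (cases n) (auto simp: simple_graph_def)
qed

lemma edge_lipschitz_imp_lipschitz:
  fixes f :: "'a \<Rightarrow> real"
  assumes "connected_graph E" and edge: "\<And>u v. {u, v} \<in> E \<Longrightarrow> \<bar>f u - f v\<bar> \<le> K"
  shows "\<bar>f x - f y\<bar> \<le> K * real (graph_dist E x y)"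
proof -
  have "\<bar>f x - f y\<bar> \<le> K * real n" if "(x, y) \<in> adj E ^^ n" for n
    using that
  proof (induction n arbitrary: y)
    case (Suc n)
    then obtain z where z: "(x, z) \<in> adj E ^^ n" and "(z, y) \<in> adj E"
      by auto
    then have "\<bar>f z - f y\<bar> \<le> K"
      using edge by (simp add: adj_def)
    with Suc.IH[OF z] show ?case
      by (simp add: algebra_simps)
  qed simp
  then show ?thesis
    using graph_dist_relpow[OF assms(1)] by blast
qed

text \<open>The other terms are nonnegative, so one edge bounds the sum from below. Both
  orientations must be bounded because the \<open>SOME\<close> in \<open>edge_sum\<close> may pick
  either.\<close>

lemma edge_sum_ge:
  fixes E :: "'a::finite set set"
  assumes "simple_graph E" and "{x, y} \<in> E" and nonneg: "\<And>u v. f u v \<ge> 0"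
    and "b \<le> f x y" and "b \<le> f y x"
  shows "b \<le> edge_sum E f"
proof -
  define r where "r e = (SOME r. \<exists>x y. e = {x, y} \<and> r = f x y)" for e
  have r: "\<exists>u v. e = {u, v} \<and> r e = f u v" if "e \<in> E" for e
  proof -
    have "\<exists>r u v. e = {u, v} \<and> r = f u v"
      using assms(1) that by (metis card_2_iff simple_graph_def)
    then show ?thesis
      unfolding r_def by (rule someI_ex)
  qed
  have "b \<le> r {x, y}"
    using r[OF assms(2)] assms(4,5) by (metis doubleton_eq_iff)
  also have "\<dots> \<le> sum r E"
    using assms(2) by (rule member_le_sum) (metis DiffD1 r nonneg, simp)
  finally show ?thesis
    by (simp add: edge_sum_def r_def)
qed

section \<open>The Laplacian in coordinates and its symmetrization\<close>

lemma matrix_inv_deg_matrix: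
  fixes E :: "'a::finite set set"
  assumes "\<And>x. deg E x > 0"
  shows "matrix_inv (deg_matrix E) = (\<chi> x y. if x = y then 1 / real (deg E x) else 0)"
    (is "_ = ?B")
proof -
  have 1: "deg_matrix E ** ?B = mat 1" and 2: "?B ** deg_matrix E = mat 1"
    using assms by (auto simp: vec_eq_iff matrix_matrix_mult_def deg_matrix_def mat_def
      mult_delta_left less_imp_neq[symmetric])
  \<comment> \<open>\<open>matrix_inv\<close> is a Hilbert choice, so it is known to be an inverse
    only after invertibility; uniqueness of inverses then identifies it with
    \<open>?B\<close>.\<close>
  have "invertible (deg_matrix E)"
    using 1 2 by (auto simp: invertible_def)
  then have "matrix_inv (deg_matrix E) ** deg_matrix E = mat 1"
    unfolding invertible_def matrix_inv_def by (rule someI2_ex) simp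
  then have "(matrix_inv (deg_matrix E) ** deg_matrix E) ** ?B = ?B"
    by (simp only: matrix_mul_lid)
  then show ?thesis
    by (simp only: 1 matrix_mul_rid flip: matrix_mul_assoc)
qed

lemma laplacian_mult_component:
  fixes E :: "'a::finite set set"
  assumes "\<And>x. deg E x > 0"
  shows "(laplacian E *v v) $ x = v $ x - (\<Sum>y\<in>nbrs E x. v $ y) / real (deg E x)"
proof -
  have "(adj_matrix E *v v) $ x = (\<Sum>y\<in>nbrs E x. v $ y)" for x
    by (simp add: matrix_vector_mult_def adj_matrix_def nbrs_def insert_commute mult_delta_left
      sum.If_cases)
  moreover have "(matrix_inv (deg_matrix E) *v w) $ x = w $ x / real (deg E x)" for w
    by (simp add: matrix_inv_deg_matrix[OF assms] matrix_vector_mult_def mult_delta_left)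
  ultimately show ?thesis
    by (simp add: laplacian_def matrix_vector_mult_diff_rdistrib
        flip: matrix_vector_mul_assoc)
qed

text \<open>The conjugate of the Laplacian by the square root of the degree matrix.  Unlike the Laplacian it
  is self-adjoint, which ensures that the minimum defining \<^const>\<open>lambda1\<close> is taken over a finite
  nonempty set.\<close>

definition normalized_laplacian :: "'a::finite set set \<Rightarrow> real^'a \<Rightarrow> real^'a" where
  "normalized_laplacian E w = (\<chi> x. w $ x
     - (\<Sum>y\<in>nbrs E x. w $ y / sqrt (real (deg E y))) / sqrt (real (deg E x)))"

lemma linear_normalized_laplacian: "linear (normalized_laplacian E)"
  by (rule linearI)
    (simp_all add: normalized_laplacian_def vec_eq_iff add_divide_distrib sum.distrib
      right_diff_distrib flip: sum_distrib_left times_divide_eq_right)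

lemma normalized_laplacian_self_adjoint:
  "u \<bullet> normalized_laplacian E v = normalized_laplacian E u \<bullet> v"
proof -
  define s where "s x = sqrt (real (deg E x))" for x
  \<comment> \<open>The bilinear form of the adjacency matrix scaled by inverse square roots of
    degrees on both sides; it is symmetric because adjacency is.\<close>
  define B where "B u v = (\<Sum>x\<in>UNIV. \<Sum>y\<in>UNIV.
    if y \<in> nbrs E x then (u $ x / s x) * (v $ y / s y) else 0)" for u v :: "real^'a"
  have eq: "u \<bullet> normalized_laplacian E v = u \<bullet> v - B u v" for u v
    by (simp add: inner_vec_def normalized_laplacian_def B_def s_def right_diff_distrib
      sum_subtractf sum.If_cases sum_distrib_left sum_divide_distrib mult_ac)
  have "B u v = B v u"
    unfolding B_def by (subst sum.swap) (simp add: mem_nbrs_commute mult.commute cong: if_cong)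
  then show ?thesis
    using eq[of u v] eq[of v u] by (simp add: inner_commute)
qed

text \<open>Multiplying the entries of an eigenvector by the square roots of the degrees carries one
  operator to the other. Positive degrees make this invertible, so nonzero vectors stay
  nonzero.\<close>

lemma eigenvalue_laplacian_iff:
  fixes E :: "'a::finite set set"
  assumes pos: "\<And>x. deg E x > 0"
  shows "eigenvalue (laplacian E) c \<longleftrightarrow> (\<exists>w. w \<noteq> 0 \<and> normalized_laplacian E w = c *\<^sub>R w)"
proof
  have s: "sqrt (real (deg E x)) \<noteq> 0" for x
    using pos[of x] by simp
  {
    assume "eigenvalue (laplacian E) c"
    then obtain v where v: "v \<noteq> 0" "laplacian E *v v = c *\<^sub>R v"
      by (auto simp: eigenvalue_def)
    define w :: "real^'a" where "w = (\<chi> x. sqrt (real (deg E x)) * v $ x)"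
    have "w \<noteq> 0"
      using v(1) s by (auto simp: w_def vec_eq_iff)
    moreover have "normalized_laplacian E w $ x = (c *\<^sub>R w) $ x" for x
    proof -
      have "v $ x - (\<Sum>y\<in>nbrs E x. v $ y) / real (deg E x) = c * v $ x"
        using v(2) laplacian_mult_component[OF pos, of v x] by simp
      then have "sqrt (deg E x) * (v $ x - (\<Sum>y\<in>nbrs E x. v $ y) / real (deg E x))
          = c * (sqrt (deg E x) * v $ x)"
        by simp
      moreover have "sqrt (deg E x) * (a / real (deg E x)) = a / sqrt (deg E x)" for a
      proof -
        have "sqrt (deg E x) * (a / real (deg E x)) = a * (sqrt (deg E x) / real (deg E x))"
          by simp
        then show ?thesis
          by (simp only: sqrt_divide_self_eq of_nat_0_le_iff divide_inverse[of a])
      qed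
      moreover have "w $ y / sqrt (deg E y) = v $ y" for y
        using s[of y] by (simp add: w_def)
      ultimately show ?thesis
        by (simp add: normalized_laplacian_def w_def right_diff_distrib)
    qed
    ultimately show "\<exists>w. w \<noteq> 0 \<and> normalized_laplacian E w = c *\<^sub>R w"
      by (metis vec_eq_iff)
  }
  {
    assume "\<exists>w. w \<noteq> 0 \<and> normalized_laplacian E w = c *\<^sub>R w"
    then obtain w where w: "w \<noteq> 0" "normalized_laplacian E w = c *\<^sub>R w"
      by auto
    define v :: "real^'a" where "v = (\<chi> x. w $ x / sqrt (real (deg E x)))"
    have "v \<noteq> 0"
      using w(1) s by (auto simp: v_def vec_eq_iff)
    moreover have "(laplacian E *v v) $ x = (c *\<^sub>R v) $ x" for x
    proof -
      have "w $ x - (\<Sum>y\<in>nbrs E x. v $ y) / sqrt (deg E x) = c * w $ x"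
        using arg_cong[OF w(2), of "\<lambda>z. z $ x"] by (simp add: normalized_laplacian_def v_def)
      then have "(w $ x - (\<Sum>y\<in>nbrs E x. v $ y) / sqrt (deg E x)) / sqrt (deg E x)
          = c * w $ x / sqrt (deg E x)"
        by simp
      then show ?thesis
        by (simp add: laplacian_mult_component[OF pos] diff_divide_distrib v_def)
    qed
    ultimately show "eigenvalue (laplacian E) c"
      unfolding eigenvalue_def by (metis vec_eq_iff)
  }
qed

lemma lambda1_is_eigenvalue:
  fixes E :: "'a::finite set set"
  assumes "simple_graph E" and pos: "\<And>x. deg E x > 0"
  shows "eigenvalue (laplacian E) (lambda1 E)" and "lambda1 E \<noteq> 0"
proof -
  let ?S = "{c. eigenvalue (laplacian E) c \<and> c \<noteq> 0}"
  have "finite {c. eigenvalue (laplacian E) c}"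
    unfolding eigenvalue_laplacian_iff[OF pos]
    by (intro finite_eigenvalues_self_adjoint normalized_laplacian_self_adjoint)
  then have "finite ?S"
    by (rule rev_finite_subset) auto
  obtain x :: 'a where "x \<in> UNIV"
    by auto
  \<comment> \<open>Without loops the diagonal entries of the normalized Laplacian are 1, so a basis
    vector witnesses a positive Rayleigh quotient and hence a nonzero eigenvalue.\<close>
  have "(\<Sum>y\<in>nbrs E x. (axis x 1 :: real^'a) $ y / sqrt (real (deg E y))) = 0"
    using not_self_nbr[OF assms(1), of x] by (intro sum.neutral) (auto simp: axis_def)
  then have "axis x 1 \<bullet> normalized_laplacian E (axis x 1) = 1"
    by (simp add: inner_axis' normalized_laplacian_def)
  then have "\<exists>c>0. \<exists>w. w \<noteq> 0 \<and> normalized_laplacian E w = c *\<^sub>R w"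
    by (intro positive_eigenvalue_exists[where a = "axis x 1"] linear_normalized_laplacian
        normalized_laplacian_self_adjoint) simp
  then have "?S \<noteq> {}"
    using eigenvalue_laplacian_iff[OF pos] by fastforce
  from Min_in[OF \<open>finite ?S\<close> this]
  show "eigenvalue (laplacian E) (lambda1 E)" and "lambda1 E \<noteq> 0"
    by (simp_all add: lambda1_def)
qed

section \<open>Wasserstein distance\<close>

lemma wasserstein_le:
  assumes "coupling m1 m2 A"
  shows "wasserstein E m1 m2 \<le> (\<Sum>x\<in>UNIV. \<Sum>y\<in>UNIV. A x y * real (graph_dist E x y))"
  unfolding wasserstein_def
proof (rule cINF_lower)
  \<comment> \<open>A real \<open>INF\<close> is a lower bound only for a family bounded below; here
    all costs are nonnegative.\<close>
  show "bdd_below ((\<lambda>A. \<Sum>x\<in>UNIV. \<Sum>y\<in>UNIV. A x y * real (graph_dist E x y))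
      ` {A. coupling m1 m2 A})"
    by (rule bdd_belowI2[where m = 0])
      (auto simp: coupling_def intro!: sum_nonneg)
qed (use assms in simp)

text \<open>The independent coupling shows that the infimum in \<open>wasserstein\<close> ranges
  over a nonempty set, as lower bounds on it require.\<close>

lemma coupling_product:
  assumes "\<And>v. m1 v \<ge> 0" "sum m1 UNIV = 1" "\<And>v. m2 v \<ge> 0" "sum m2 UNIV = 1"
  shows "coupling m1 m2 (\<lambda>x y. m1 x * m2 y)"
proof -
  have le1: "m v \<le> 1" if "\<And>v. m v \<ge> 0" "sum m UNIV = 1" for m :: "'a \<Rightarrow> real" and v
    using member_le_sum[of v UNIV m] that by simp
  show ?thesis
    using assms le1[of m1] le1[of m2]
    by (auto simp: coupling_def mult_le_one simp flip: sum_distrib_left sum_distrib_right)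
qed

lemma wasserstein_ge:
  assumes "\<And>v. m1 v \<ge> 0" "sum m1 UNIV = 1" "\<And>v. m2 v \<ge> 0" "sum m2 UNIV = 1"
    and "\<And>A. coupling m1 m2 A \<Longrightarrow> b \<le> (\<Sum>x\<in>UNIV. \<Sum>y\<in>UNIV. A x y * real (graph_dist E x y))"
  shows "b \<le> wasserstein E m1 m2"
  unfolding wasserstein_def
  using coupling_product[OF assms(1-4)] assms(5) by (intro cINF_greatest) auto

text \<open>Under any coupling the difference of the two means is the mean of
  \<open>f x - f y\<close>, at most \<open>K\<close> times the cost. Dividing by
  \<open>K > 0\<close> makes this a lower bound for the infimum.\<close>

lemma wasserstein_dual_bound:
  fixes f :: "'a::finite \<Rightarrow> real"
  assumes m: "\<And>v. m1 v \<ge> 0" "sum m1 UNIV = 1" "\<And>v. m2 v \<ge> 0" "sum m2 UNIV = 1"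
    and lip: "\<And>x y. f x - f y \<le> K * real (graph_dist E x y)" and "K > 0"
  shows "(\<Sum>v\<in>UNIV. m1 v * f v) - (\<Sum>v\<in>UNIV. m2 v * f v) \<le> K * wasserstein E m1 m2"
proof -
  let ?D = "(\<Sum>v\<in>UNIV. m1 v * f v) - (\<Sum>v\<in>UNIV. m2 v * f v)"
  have "?D / K \<le> wasserstein E m1 m2"
  proof (rule wasserstein_ge[OF m])
    fix A
    assume A: "coupling m1 m2 A"
    have "(\<Sum>v\<in>UNIV. m1 v * f v) = (\<Sum>x\<in>UNIV. \<Sum>y\<in>UNIV. A x y * f x)"
      using A by (simp add: coupling_def flip: sum_distrib_right)
    moreover have "(\<Sum>v\<in>UNIV. m2 v * f v) = (\<Sum>x\<in>UNIV. \<Sum>y\<in>UNIV. A x y * f y)"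
      using A by (subst sum.swap) (simp add: coupling_def flip: sum_distrib_right)
    ultimately have "?D = (\<Sum>x\<in>UNIV. \<Sum>y\<in>UNIV. A x y * (f x - f y))"
      by (simp add: right_diff_distrib sum_subtractf)
    also have "\<dots> \<le> (\<Sum>x\<in>UNIV. \<Sum>y\<in>UNIV. A x y * (K * real (graph_dist E x y)))"
      using A lip by (intro sum_mono mult_left_mono) (auto simp: coupling_def)
    also have "\<dots> = K * (\<Sum>x\<in>UNIV. \<Sum>y\<in>UNIV. A x y * real (graph_dist E x y))"
      by (simp add: sum_distrib_left mult_ac)
    finally show "?D / K \<le> (\<Sum>x\<in>UNIV. \<Sum>y\<in>UNIV. A x y * real (graph_dist E x y))"
      using \<open>K > 0\<close> by (simp add: field_simps)
  qed
  then show ?thesis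
    using \<open>K > 0\<close> by (simp add: field_simps)
qed

section \<open>Curvature along a steepest edge of an eigenvector\<close>

lemma walk_measure_expectation:
  fixes E :: "'a::finite set set"
  assumes "simple_graph E"
  shows "(\<Sum>v\<in>UNIV. walk_measure E \<alpha> x v * f v)
    = \<alpha> * f x + (1 - \<alpha>) / real (deg E x) * (\<Sum>v\<in>nbrs E x. f v)"
proof -
  \<comment> \<open>A vertex is not its own neighbour, so the nested conditional splits into a sum
    of two disjoint cases.\<close>
  have "walk_measure E \<alpha> x v * f v = (if v = x then \<alpha> * f v else 0)
      + (if v \<in> nbrs E x then (1 - \<alpha>) / real (deg E x) * f v else 0)" for v
    using not_self_nbr[OF assms] by (auto simp: walk_measure_def)
  then show ?thesis
    by (simp add: sum.distrib sum.If_cases sum_distrib_left)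
qed

lemma walk_measure_nonneg:
  assumes "0 \<le> \<alpha>" "\<alpha> \<le> 1"
  shows "walk_measure E \<alpha> x v \<ge> 0"
  using assms by (simp add: walk_measure_def)

lemma sum_walk_measure:
  fixes E :: "'a::finite set set"
  assumes "simple_graph E" and "deg E x > 0"
  shows "sum (walk_measure E \<alpha> x) UNIV = 1"
  using walk_measure_expectation[OF assms(1), of \<alpha> x "\<lambda>_. 1"] assms(2)
  by (auto simp: deg_def)

section \<open>Dependence of the curvature on the idleness\<close>

lemma walk_measure_mix:
  "walk_measure E (1 - t * (1 - \<alpha>)) x v = t * walk_measure E \<alpha> x v + (1 - t) * (if v = x then 1 else 0)"
  by (simp add: walk_measure_def algebra_simps)

lemma wasserstein_walk_mix:
  fixes E :: "'a::finite set set"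
  assumes "simple_graph E" and pos: "\<And>x. deg E x > 0"
    and "0 \<le> \<alpha>" "\<alpha> \<le> 1" and "0 < t" "t \<le> 1"
  defines "\<beta> \<equiv> 1 - t * (1 - \<alpha>)"
  shows "wasserstein E (walk_measure E \<beta> x) (walk_measure E \<beta> y)
    \<le> t * wasserstein E (walk_measure E \<alpha> x) (walk_measure E \<alpha> y) + (1 - t) * real (graph_dist E x y)"
    (is "?W \<le> t * ?V + ?r")
proof -
  have "(?W - ?r) / t \<le> ?V"
  proof (rule wasserstein_ge)
    fix A
    assume A: "coupling (walk_measure E \<alpha> x) (walk_measure E \<alpha> y) A"
    \<comment> \<open>Mixing \<open>A\<close> with the point mass at \<open>(x, y)\<close>, which
      couples the two Dirac measures at cost \<open>graph_dist E x y\<close>, couples the lazier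
      walks.\<close>
    define B where "B u v = t * A u v + (1 - t) * (if u = x then if v = y then 1 else 0 else 0)"
      for u v
    have "coupling (walk_measure E \<beta> x) (walk_measure E \<beta> y) B"
      unfolding coupling_def
    proof (intro conjI allI)
      show "(\<Sum>v\<in>UNIV. B u v) = walk_measure E \<beta> x u" for u
        using A by (simp add: coupling_def B_def \<beta>_def walk_measure_mix sum.distrib
            flip: sum_distrib_left)
      show "(\<Sum>u\<in>UNIV. B u v) = walk_measure E \<beta> y v" for v
        using A by (simp add: coupling_def B_def \<beta>_def walk_measure_mix sum.distrib
            flip: sum_distrib_left)
      show "B u v \<in> {0..1}" for u v
      proof -
        have "0 \<le> A u v" "A u v \<le> 1"
          using A by (simp_all add: coupling_def)
        then have "0 \<le> t * A u v" "t * A u v \<le> t"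
          using assms(5) by (simp_all add: mult_left_le)
        then show ?thesis
          using assms(6) by (auto simp: B_def)
      qed
    qed
    then have "?W \<le> (\<Sum>u\<in>UNIV. \<Sum>v\<in>UNIV. B u v * real (graph_dist E u v))"
      by (rule wasserstein_le)
    also have "\<dots> = t * (\<Sum>u\<in>UNIV. \<Sum>v\<in>UNIV. A u v * real (graph_dist E u v)) + ?r"
    proof -
      have "B u v * real (graph_dist E u v) = t * (A u v * real (graph_dist E u v))
          + (if u = x then if v = y then ?r else 0 else 0)" for u v
        by (simp add: B_def algebra_simps)
      moreover have "(\<Sum>v\<in>UNIV. if u = x then if v = y then ?r else 0 else 0)
          = (if u = x then ?r else 0)" for u
        by simp
      ultimately show ?thesis
        by (simp add: sum.distrib sum_distrib_left)
    qed
    finally show "(?W - ?r) / t \<le> (\<Sum>u\<in>UNIV. \<Sum>v\<in>UNIV. A u v * real (graph_dist E u v))"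
      using \<open>0 < t\<close> by (simp add: field_simps)
  qed (use assms in \<open>auto intro: walk_measure_nonneg sum_walk_measure\<close>)
  then show ?thesis
    using \<open>0 < t\<close> by (simp add: field_simps)
qed

lemma curv_ratio_mono:
  fixes E :: "'a::finite set set"
  assumes "simple_graph E" and pos: "\<And>x. deg E x > 0" and edge: "{x, y} \<in> E"
    and "0 \<le> \<alpha>" "\<alpha> \<le> \<beta>" "\<beta> < 1"
  shows "curv E \<alpha> x y / (1 - \<alpha>) \<le> curv E \<beta> x y / (1 - \<beta>)"
proof -
  \<comment> \<open>The mixing weight that raises the idleness from \<alpha> to \<beta>. Since
    adjacent vertices are at distance 1, the mixing bound becomes
    \<open>t * curv E \<alpha> x y \<le> curv E \<beta> x y\<close>.\<close>
  define t where "t = (1 - \<beta>) / (1 - \<alpha>)"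
  have t: "0 < t" "t \<le> 1" and \<beta>: "1 - t * (1 - \<alpha>) = \<beta>"
    using assms(4-6) by (simp_all add: t_def field_simps)
  have "t * curv E \<alpha> x y \<le> curv E \<beta> x y"
    using wasserstein_walk_mix[OF assms(1) pos, of \<alpha> t x y, unfolded \<beta>] assms(4-6) t
    by (simp add: curv_def graph_dist_adjacent[OF assms(1) edge] algebra_simps)
  then show ?thesis
    using assms(4-6) by (simp add: t_def field_simps)
qed

text \<open>A monotone ratio bounded by \<open>c\<close> converges from the left to its supremum.
  This also establishes the convergence that gives the \<open>Lim\<close> in \<open>curv_LLY\<close>
  its meaning.\<close>

lemma curv_LLY_le:
  fixes E :: "'a::finite set set"
  assumes "simple_graph E" and pos: "\<And>x. deg E x > 0" and edge: "{x, y} \<in> E"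
    and bound: "\<And>\<alpha>. 0 \<le> \<alpha> \<Longrightarrow> \<alpha> < 1 \<Longrightarrow> curv E \<alpha> x y \<le> (1 - \<alpha>) * c"
  shows "curv_LLY E x y \<le> c"
proof -
  let ?h = "\<lambda>\<alpha>. curv E \<alpha> x y / (1 - \<alpha>)"
  have le: "?h \<alpha> \<le> c" if "\<alpha> \<in> {0..}" "\<alpha> < 1" for \<alpha>
    using bound[of \<alpha>] that by (simp add: field_simps)
  have "(?h \<longlongrightarrow> Sup (?h ` ({..<1} \<inter> {0..}))) (at 1 within ({..<1} \<inter> {0..}))"
    by (rule Lim_left_bound[where K = c])
      (use le in \<open>auto intro: curv_ratio_mono[OF assms(1) pos edge]\<close>)
  \<comment> \<open>Restricting to nonnegative idleness leaves the filter unchanged, since it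
    depends only on points near 1.\<close>
  also have "at 1 within ({..<1} \<inter> {0..}) = at_left (1::real)"
    by (rule at_within_nhd[where S = "{0<..}"]) auto
  finally have "curv_LLY E x y = Sup (?h ` ({..<1} \<inter> {0..}))"
    unfolding curv_LLY_def by (intro tendsto_Lim) auto
  also have "\<dots> \<le> c"
  proof (rule cSUP_least)
    have "0 \<in> {..<1} \<inter> {0::real..}"
      by simp
    then show "{..<1} \<inter> {0..} \<noteq> ({} :: real set)"
      by blast
  qed (use le in auto)
  finally show ?thesis .
qed

text \<open>The edge is fixed before \<alpha>, so that the bound survives the limit along one edge;
  both orientations are supplied for \<open>edge_sum_ge\<close>.\<close>

lemma eigenvalue_curv_bound:
  fixes E :: "'a::finite set set"
  assumes "simple_graph E" and "connected_graph E" and pos: "\<And>x. deg E x > 0"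
    and "eigenvalue (laplacian E) c" and "c \<noteq> 0"
  obtains x y where "{x, y} \<in> E"
    and "\<And>\<alpha>. 0 \<le> \<alpha> \<Longrightarrow> \<alpha> < 1 \<Longrightarrow> curv E \<alpha> x y \<le> (1 - \<alpha>) * c"
    and "\<And>\<alpha>. 0 \<le> \<alpha> \<Longrightarrow> \<alpha> < 1 \<Longrightarrow> curv E \<alpha> y x \<le> (1 - \<alpha>) * c"
proof -
  obtain w where w: "w \<noteq> 0" "laplacian E *v w = c *\<^sub>R w"
    using assms(4) by (auto simp: eigenvalue_def)
  define f where "f x = w $ x" for x
  have eig: "f x - (\<Sum>y\<in>nbrs E x. f y) / real (deg E x) = c * f x" for x
    using laplacian_mult_component[OF pos, of w x] w(2) by (simp add: f_def)
  define K where "K = Max ((\<lambda>(x, y). \<bar>f x - f y\<bar>) ` adj E)"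
  \<comment> \<open>Here \<open>undefined\<close> is merely some vertex; its positive degree
    supplies an edge, so the maximum \<open>K\<close> is over a nonempty set.\<close>
  have "nbrs E undefined \<noteq> {}"
    using pos[of undefined] by (auto simp: deg_def)
  then have "adj E \<noteq> {}"
    by (auto simp: adj_def nbrs_def)
  then have "K \<in> (\<lambda>(x, y). \<bar>f x - f y\<bar>) ` adj E"
    unfolding K_def by (intro Max_in) auto
  then obtain x y where xy: "{x, y} \<in> E" "K = \<bar>f x - f y\<bar>"
    by (auto simp: adj_def)
  have edge: "\<bar>f u - f v\<bar> \<le> K" if "{u, v} \<in> E" for u v
    unfolding K_def using that by (intro Max_ge) (auto simp: adj_def image_iff intro!: bexI[of _ "(u, v)"])
  \<comment> \<open>If \<open>K\<close> were 0, every value of \<open>f\<close> would equal the mean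
    over its neighbours, forcing \<open>c * f u = 0\<close> everywhere although \<open>c\<close> and
    \<open>w\<close> are nonzero.\<close>
  have "K \<noteq> 0"
  proof
    assume "K = 0"
    have "c * f u = 0" for u
    proof -
      have "(\<Sum>v\<in>nbrs E u. f v) = (\<Sum>v\<in>nbrs E u. f u)"
        using edge \<open>K = 0\<close> by (intro sum.cong) (auto simp: nbrs_def)
      then show ?thesis
        using eig[of u] pos[of u] by (auto simp: deg_def split: if_splits)
    qed
    then show False
      using w(1) \<open>c \<noteq> 0\<close> by (simp add: f_def vec_eq_iff)
  qed
  then have "K > 0"
    using xy(2) by simp
  have lip: "\<bar>f u - f v\<bar> \<le> K * real (graph_dist E u v)" for u v
    using edge_lipschitz_imp_lipschitz[OF assms(2) edge] .
  have bound: "curv E \<alpha> u v \<le> (1 - \<alpha>) * c"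
    if uv: "{u, v} \<in> E" "K = \<bar>f u - f v\<bar>" and \<alpha>: "0 \<le> \<alpha>" "\<alpha> < 1" for u v \<alpha>
  proof -
    have expect: "(\<Sum>z\<in>UNIV. walk_measure E \<alpha> x z * f z) = (1 - (1 - \<alpha>) * c) * f x" for x
    proof -
      have "(\<Sum>z\<in>nbrs E x. f z) / real (deg E x) = (1 - c) * f x"
        using eig[of x] by (simp add: algebra_simps)
      then have "(1 - \<alpha>) / real (deg E x) * (\<Sum>z\<in>nbrs E x. f z) = (1 - \<alpha>) * ((1 - c) * f x)"
        by (metis times_divide_eq_left times_divide_eq_right)
      then show ?thesis
        unfolding walk_measure_expectation[OF assms(1)] by (simp add: algebra_simps)
    qed
    \<comment> \<open>The sign orients \<open>f\<close> so that its drop from \<open>u\<close> to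
      \<open>v\<close> is exactly \<open>K\<close>, while the Lipschitz constant stays at most
      \<open>K\<close>.\<close>
    define \<sigma> where "\<sigma> = sgn (f u - f v)"
    have \<sigma>: "\<sigma> * (f u - f v) = K" and "\<bar>\<sigma>\<bar> \<le> 1"
      using uv(2) by (simp_all add: \<sigma>_def sgn_if)
    let ?W = "wasserstein E (walk_measure E \<alpha> u) (walk_measure E \<alpha> v)"
    have "(\<Sum>z\<in>UNIV. walk_measure E \<alpha> u z * (\<sigma> * f z))
        - (\<Sum>z\<in>UNIV. walk_measure E \<alpha> v z * (\<sigma> * f z)) \<le> K * ?W"
    proof (rule wasserstein_dual_bound)
      fix a b
      have "\<sigma> * f a - \<sigma> * f b \<le> \<bar>\<sigma>\<bar> * \<bar>f a - f b\<bar>"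
        by (metis abs_ge_self abs_mult right_diff_distrib)
      also have "\<dots> \<le> \<bar>f a - f b\<bar>"
        using \<open>\<bar>\<sigma>\<bar> \<le> 1\<close> by (simp add: mult_left_le_one_le)
      finally show "\<sigma> * f a - \<sigma> * f b \<le> K * real (graph_dist E a b)"
        using lip[of a b] by linarith
    qed (use \<alpha> \<open>K > 0\<close> assms(1) pos in \<open>auto intro: walk_measure_nonneg sum_walk_measure\<close>)
    moreover have "(\<Sum>z\<in>UNIV. walk_measure E \<alpha> x z * (\<sigma> * f z)) = \<sigma> * ((1 - (1 - \<alpha>) * c) * f x)" for x
      unfolding expect[symmetric] by (simp add: sum_distrib_left mult_ac)
    moreover have "\<sigma> * ((1 - (1 - \<alpha>) * c) * f u) - \<sigma> * ((1 - (1 - \<alpha>) * c) * f v)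
        = (1 - (1 - \<alpha>) * c) * (\<sigma> * (f u - f v))"
      by (simp add: algebra_simps)
    ultimately have "K * (1 - (1 - \<alpha>) * c) \<le> K * ?W"
      by (simp add: \<sigma> mult.commute)
    then have "1 - (1 - \<alpha>) * c \<le> ?W"
      using \<open>K > 0\<close> by simp
    then show ?thesis
      by (simp add: curv_def graph_dist_adjacent[OF assms(1) uv(1)])
  qed
  show thesis
    using bound[of x y] bound[of y x] xy
    by (intro that[of x y]) (auto simp: insert_commute abs_minus_commute)
qed

theorem theorem1p3:
  fixes E :: "'a::finite set set" and \<kappa>0 \<alpha> :: real
  assumes "simple_graph E" and "connected_graph E" and "CARD('a) \<ge> 2"
    and "\<kappa>0 > 0" and "0 \<le> \<alpha>" and "\<alpha> < 1"
  shows "lambda1 E \<ge> \<kappa>0 - total_deficit E \<alpha> \<kappa>0 / (1 - \<alpha>) \<and>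
         lambda1 E \<ge> \<kappa>0 - total_deficit_LLY E \<kappa>0"
proof
  have pos: "deg E x > 0" for x
    using deg_pos[OF assms(2,3)] .
  obtain x y where xy: "{x, y} \<in> E"
    and bound: "\<And>\<alpha>. 0 \<le> \<alpha> \<Longrightarrow> \<alpha> < 1 \<Longrightarrow> curv E \<alpha> x y \<le> (1 - \<alpha>) * lambda1 E"
      "\<And>\<alpha>. 0 \<le> \<alpha> \<Longrightarrow> \<alpha> < 1 \<Longrightarrow> curv E \<alpha> y x \<le> (1 - \<alpha>) * lambda1 E"
    using eigenvalue_curv_bound[OF assms(1,2) pos lambda1_is_eigenvalue[OF assms(1) pos]] by metis
  have yx: "{y, x} \<in> E"
    using xy by (simp add: insert_commute)
  \<comment> \<open>On the chosen edge
    \<open>(1 - \<alpha>) * \<kappa>0 - curv E \<alpha> x y\<close> is at least this left-hand side,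
    and the deficit is at least that difference.\<close>
  have "(1 - \<alpha>) * (\<kappa>0 - lambda1 E) \<le> total_deficit E \<alpha> \<kappa>0"
    unfolding total_deficit_def
    by (rule edge_sum_ge[OF assms(1) xy])
      (use bound[OF assms(5,6)] in \<open>auto simp: deficit_def algebra_simps\<close>)
  then show "lambda1 E \<ge> \<kappa>0 - total_deficit E \<alpha> \<kappa>0 / (1 - \<alpha>)"
    using assms(6) by (simp add: field_simps)
  have "\<kappa>0 - lambda1 E \<le> total_deficit_LLY E \<kappa>0"
    unfolding total_deficit_LLY_def
    by (rule edge_sum_ge[OF assms(1) xy])
      (use curv_LLY_le[OF assms(1) pos xy bound(1)] curv_LLY_le[OF assms(1) pos yx bound(2)]
       in \<open>auto simp: deficit_LLY_def\<close>)
  then show "lambda1 E \<ge> \<kappa>0 - total_deficit_LLY E \<kappa>0"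
    by simp
qed

end
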